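(* Let $G$ and $H$ be finite graphs and let $q$ be a non-negative integer. Then $$P_{G+H}(q)=\sum_{\substack{s,t\ge 0\\ s+t\le q}}(-1)^{q-s-t}\frac{q!}{s!\,t!\,(q-s-t)!}\,P_G(s)\,P_H(t),$$ where the summation is over all pairs $(s,t)$ of non-negative integers with sum at most $q$.
   Context: $P_G$ denotes the chromatic polynomial of $G$, so $P_G(q)$ is the number of proper vertex colourings of $G$ using colours from a set of $q$ colours. $G+H$ denotes the sum (join) of $G$ and $H$: the disjoint union of $G$ and $H$ together with all edges between vertices of $G$ and vertices of $H$. *)

theory Defs
  imports
    "HOL-Library.FuncSet"
    "HOL-Computational_Algebra.Polynomial"
    "Graph_Theory.Digraph"
begin

text \<open>
  Undirected graphs are the symmetric digraphs of the AFP entry Graph Theory: an edge is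
  represented by arcs in both directions.  The locale \<open>pseudo_graph\<close> (finite, symmetric) allows
  loops and parallel edges; its sublocale \<open>graph\<close> describes finite simple graphs.  In both,
  the graph may have no vertices.
\<close>

definition proper_colourings :: "('a, 'b) pre_digraph \<Rightarrow> 'c set \<Rightarrow> ('a \<Rightarrow> 'c) set" where
  "proper_colourings G C =
     {f \<in> verts G \<rightarrow>\<^sub>E C. \<forall>e\<in>arcs G. f (tail G e) \<noteq> f (head G e)}"

text \<open>
  Existence and uniqueness of this polynomial for finite graphs are established by
  \<open>poly_chromatic_poly\<close> and \<open>chromatic_poly_unique\<close> below.
\<close>

definition chromatic_poly :: "('a, 'b) pre_digraph \<Rightarrow> real poly" where
  "chromatic_poly G =
     (THE p. \<forall>q::nat. poly p (real q) = real (card (proper_colourings G {..<q})))"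

text \<open>
  The sum (join) of two graphs.  The vertex sets are made disjoint by \<open>Inl\<close> and \<open>Inr\<close>.
  The arcs are those of \<open>G\<close> and \<open>H\<close>, together with one arc in each direction for each pair
  consisting of a vertex of \<open>G\<close> and a vertex of \<open>H\<close>.
\<close>

datatype ('a, 'b, 'c, 'd) join_arc = ArcL 'b | ArcR 'd | Across 'a 'c | Back 'c 'a

primrec join_tail ::
  "('a, 'b) pre_digraph \<Rightarrow> ('c, 'd) pre_digraph \<Rightarrow> ('a, 'b, 'c, 'd) join_arc \<Rightarrow> 'a + 'c" where
  "join_tail G H (ArcL e) = Inl (tail G e)"
| "join_tail G H (ArcR e) = Inr (tail H e)"
| "join_tail G H (Across u v) = Inl u"
| "join_tail G H (Back v u) = Inr v"

primrec join_head ::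
  "('a, 'b) pre_digraph \<Rightarrow> ('c, 'd) pre_digraph \<Rightarrow> ('a, 'b, 'c, 'd) join_arc \<Rightarrow> 'a + 'c" where
  "join_head G H (ArcL e) = Inl (head G e)"
| "join_head G H (ArcR e) = Inr (head H e)"
| "join_head G H (Across u v) = Inr v"
| "join_head G H (Back v u) = Inl u"

definition graph_join ::
  "('a, 'b) pre_digraph \<Rightarrow> ('c, 'd) pre_digraph \<Rightarrow> ('a + 'c, ('a, 'b, 'c, 'd) join_arc) pre_digraph"
where
  "graph_join G H =
     \<lparr> verts = Inl ` verts G \<union> Inr ` verts H,
       arcs = ArcL ` arcs G \<union> ArcR ` arcs H
              \<union> {Across u v | u v. u \<in> verts G \<and> v \<in> verts H}
              \<union> {Back v u | u v. u \<in> verts G \<and> v \<in> verts H},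
       tail = join_tail G H,
       head = join_head G H \<rparr>"

lemma arcs_ends_graph_join:
  fixes G :: "('a, 'b) pre_digraph" and H :: "('c, 'd) pre_digraph"
  shows "arcs_ends (graph_join G H) =
     map_prod Inl Inl ` arcs_ends G \<union> map_prod Inr Inr ` arcs_ends H
     \<union> Inl ` verts G \<times> Inr ` verts H \<union> Inr ` verts H \<times> Inl ` verts G"
proof -
  have "f ` {Across u v | u v. u \<in> verts G \<and> v \<in> verts H} =
          (\<lambda>(u, v). f (Across u v)) ` (verts G \<times> verts H)"
       "f ` {Back v u | u v. u \<in> verts G \<and> v \<in> verts H} =
          (\<lambda>(v, u). f (Back v u)) ` (verts H \<times> verts G)"
    for f :: "('a, 'b, 'c, 'd) join_arc \<Rightarrow> ('a + 'c) \<times> ('a + 'c)"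
    by (force simp: image_iff)+
  then show ?thesis
    unfolding arcs_ends_conv graph_join_def
    by (simp add: image_Un image_image) auto
qed

lemma pseudo_graph_graph_join:
  assumes "pseudo_graph G" "pseudo_graph H"
  shows "pseudo_graph (graph_join G H)"
proof -
  interpret G: pseudo_graph G by fact
  interpret H: pseudo_graph H by fact
  have fin: "finite {Across u v | u v. u \<in> verts G \<and> v \<in> verts H}"
       "finite {Back v u | u v. u \<in> verts G \<and> v \<in> verts H}"
    by (rule finite_image_set2; simp)+
  show ?thesis
  proof
    show "symmetric (graph_join G H)"
      using G.sym_arcs H.sym_arcs
      unfolding symmetric_def arcs_ends_graph_join
      by (auto simp: sym_def image_iff Bex_def)
  qed (use fin in \<open>auto simp: graph_join_def\<close>)
qed

lemma graph_graph_join: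
  assumes "graph G" "graph H"
  shows "graph (graph_join G H)"
proof -
  interpret G: graph G by fact
  interpret H: graph H by fact
  interpret J: pseudo_graph "graph_join G H"
    by (rule pseudo_graph_graph_join) unfold_locales
  show ?thesis
    by unfold_locales
       (auto simp: graph_join_def arc_to_ends_def
          dest: G.no_loops H.no_loops G.no_multi_arcs H.no_multi_arcs)
qed

lemma finite_proper_colourings:
  assumes "finite (verts G)" "finite C"
  shows "finite (proper_colourings G C)"
  by (rule finite_subset[OF _ finite_PiE[of "verts G" "\<lambda>_. C"]])
     (use assms in \<open>auto simp: proper_colourings_def\<close>)

lemma card_surj_colourings:
  assumes wf: "wf_digraph G" and bij: "bij_betw h A B"
  shows "card {f \<in> proper_colourings G A. f ` verts G = A} =
         card {f \<in> proper_colourings G B. f ` verts G = B}"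
proof -
  interpret wf_digraph G by fact
  let ?X = "\<lambda>C. {f \<in> proper_colourings G C. f ` verts G = C}"
  have *: "(\<lambda>x\<in>verts G. k (f x)) \<in> ?X D"
    if k: "bij_betw k C D" and f: "f \<in> ?X C" for C D k and f :: "'a \<Rightarrow> _"
  proof -
    have "inj_on k C" "k ` C = D" using k by (auto simp: bij_betw_def)
    moreover have "f ` verts G = C" "\<And>e. e \<in> arcs G \<Longrightarrow> f (tail G e) \<noteq> f (head G e)"
      using f by (auto simp: proper_colourings_def)
    moreover have "(\<lambda>x\<in>verts G. k (f x)) ` verts G = k ` f ` verts G"
      by (auto simp: image_iff)
    ultimately show ?thesis
      by (auto simp: proper_colourings_def inj_on_eq_iff)
  qed
  let ?g = "inv_into A h"
  have g: "bij_betw ?g B A" using bij by (rule bij_betw_inv_into)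
  have "bij_betw (\<lambda>f. \<lambda>x\<in>verts G. h (f x)) (?X A) (?X B)"
  proof (rule bij_betw_byWitness[where f' = "\<lambda>f. \<lambda>x\<in>verts G. ?g (f x)"])
    show "\<forall>f\<in>?X A. (\<lambda>x\<in>verts G. ?g ((\<lambda>x\<in>verts G. h (f x)) x)) = f"
    proof
      fix f assume f: "f \<in> ?X A"
      then have "f \<in> verts G \<rightarrow>\<^sub>E A" by (simp add: proper_colourings_def)
      then show "(\<lambda>x\<in>verts G. ?g ((\<lambda>x\<in>verts G. h (f x)) x)) = f"
        using bij_betw_inv_into_left[OF bij]
        by (intro ext) (auto simp: PiE_iff extensional_def restrict_def)
    qed
    show "\<forall>f\<in>?X B. (\<lambda>x\<in>verts G. h ((\<lambda>x\<in>verts G. ?g (f x)) x)) = f"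
    proof
      fix f assume f: "f \<in> ?X B"
      then have "f \<in> verts G \<rightarrow>\<^sub>E B" by (simp add: proper_colourings_def)
      then show "(\<lambda>x\<in>verts G. h ((\<lambda>x\<in>verts G. ?g (f x)) x)) = f"
        using bij_betw_inv_into_right[OF bij]
        by (intro ext) (auto simp: PiE_iff extensional_def restrict_def)
    qed
  qed (use *[OF bij] *[OF g] in blast)+
  then show ?thesis by (rule bij_betw_same_card)
qed

lemma card_proper_colourings_eq_sum:
  assumes "fin_digraph G"
  shows "card (proper_colourings G {..<q}) =
    (\<Sum>k\<le>card (verts G). (q choose k) *
        card {f \<in> proper_colourings G {..<k}. f ` verts G = {..<k}})"
proof -
  interpret fin_digraph G by fact
  define n where "n = card (verts G)"
  let ?s = "\<lambda>k::nat. card {f \<in> proper_colourings G {..<k}. f ` verts G = {..<k}}"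
  let ?Y = "\<lambda>S::nat set. {f \<in> proper_colourings G S. f ` verts G = S}"
  let ?P = "\<lambda>k. {S. S \<subseteq> {..<q} \<and> card S = k}"
  have eq: "proper_colourings G {..<q} = (\<Union>k\<in>{..n}. \<Union>S\<in>?P k. ?Y S)"
  proof (intro equalityI subsetI)
    fix f assume f: "f \<in> proper_colourings G {..<q}"
    then have "f \<in> ?Y (f ` verts G)" "f ` verts G \<subseteq> {..<q}"
      by (auto simp: proper_colourings_def)
    moreover have "card (f ` verts G) \<le> n"
      unfolding n_def by (simp add: card_image_le)
    ultimately show "f \<in> (\<Union>k\<in>{..n}. \<Union>S\<in>?P k. ?Y S)" by blast
  next
    fix f assume "f \<in> (\<Union>k\<in>{..n}. \<Union>S\<in>?P k. ?Y S)"
    then show "f \<in> proper_colourings G {..<q}"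
      by (auto simp: proper_colourings_def PiE_iff)
  qed
  have finP: "finite (?P k)" for k
    by (rule finite_subset[of _ "Pow {..<q}"]) auto
  have finY: "finite (?Y S)" if "S \<in> ?P k" for S k
    using that finite_proper_colourings[of G S] by (auto intro: finite_subset)
  have "card (\<Union>S\<in>?P k. ?Y S) = (q choose k) * ?s k" for k
  proof -
    have "card (\<Union>S\<in>?P k. ?Y S) = (\<Sum>S\<in>?P k. card (?Y S))"
      by (rule card_UN_disjoint) (use finP finY in auto)
    also have "\<dots> = (\<Sum>S\<in>?P k. ?s k)"
    proof (rule sum.cong)
      fix S assume S: "S \<in> ?P k"
      then have "finite S" by (auto intro: finite_subset)
      then obtain h where "bij_betw h S {..<k}"
        using S ex_bij_betw_finite_nat[of S] by (auto simp: atLeast0LessThan)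
      then show "card (?Y S) = ?s k"
        using card_surj_colourings wf_digraph by blast
    qed simp
    also have "\<dots> = (q choose k) * ?s k"
      using n_subsets[of "{..<q}" k] by simp
    finally show ?thesis .
  qed
  moreover have "card (\<Union>k\<in>{..n}. \<Union>S\<in>?P k. ?Y S) = (\<Sum>k\<le>n. card (\<Union>S\<in>?P k. ?Y S))"
    by (rule card_UN_disjoint) (use finP finY in auto)
  ultimately show ?thesis unfolding eq n_def by simp
qed

lemma chromatic_poly_ex:
  assumes "fin_digraph G"
  shows "\<exists>p. \<forall>q::nat. poly p (real q) = real (card (proper_colourings G {..<q}))"
proof -
  let ?s = "\<lambda>k::nat. card {f \<in> proper_colourings G {..<k}. f ` verts G = {..<k}}"
  let ?p = "\<Sum>k\<le>card (verts G).
              smult (real (?s k) / fact k) (\<Prod>i = 0..<k. [:- real i, 1:])"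
  have "poly ?p (real q) = real (card (proper_colourings G {..<q}))" for q
    unfolding card_proper_colourings_eq_sum[OF assms]
    by (simp add: poly_sum poly_prod binomial_gbinomial gbinomial_prod_rev mult.commute)
  then show ?thesis by blast
qed

lemma poly_eq_of_nat_values:
  fixes p r :: "real poly"
  assumes "\<And>q::nat. poly p (real q) = poly r (real q)"
  shows "p = r"
proof (rule ccontr)
  assume "p \<noteq> r"
  then have "finite {x. poly (p - r) x = 0}" by (intro poly_roots_finite) simp
  moreover have "range real \<subseteq> {x. poly (p - r) x = 0}" using assms by auto
  ultimately have "finite (range real)" by (rule rev_finite_subset)
  then show False using finite_imageD[OF _ inj_of_nat] by blast
qed

lemma poly_chromatic_poly:
  assumes "fin_digraph G"
  shows "poly (chromatic_poly G) (real q) = real (card (proper_colourings G {..<q}))"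
proof -
  have "\<exists>!p. \<forall>q::nat. poly p (real q) = real (card (proper_colourings G {..<q}))"
    using chromatic_poly_ex[OF assms] by (auto intro!: poly_eq_of_nat_values)
  from theI'[OF this] show ?thesis unfolding chromatic_poly_def by blast
qed

lemma chromatic_poly_unique:
  assumes "fin_digraph G"
    and "\<And>q::nat. poly p (real q) = real (card (proper_colourings G {..<q}))"
  shows "p = chromatic_poly G"
  by (rule poly_eq_of_nat_values) (simp add: assms poly_chromatic_poly)

end

theory Submission
  imports Defs "HOL-Computational_Algebra.Formal_Power_Series"
begin

text \<open>
  Fix a palette \<open>U\<close> of \<open>n\<close> colours.  In a colouring of the join the two sides use disjoint sets of
  colours, and the theorem counts such colourings by comparing two ways of recording one together
  with some further colours of the palette.  A triple \<open>(S, f, g)\<close>, where \<open>f\<close> colours \<open>G\<close> from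
  \<open>S\<close> and \<open>g\<close> colours \<open>H\<close> from \<open>U - S\<close>, amounts to a colouring of the join and a choice of the
  unused colours that belong to \<open>S\<close>.  A pair \<open>(V, h)\<close>, where \<open>h\<close> colours the join from
  \<open>V \<subseteq> U\<close>, amounts to a colouring of the join and a choice of the unused colours that belong to
  \<open>V\<close>.  So there are equally many of both (\<open>sum_proper_colourings_graph_join\<close>), and grouping the
  subsets of \<open>U\<close> by size gives
  \<open>\<Sum>k\<le>n. (n choose k) P\<^sub>G\<^sub>+\<^sub>H(k) = \<Sum>k\<le>n. (n choose k) P\<^sub>G(k) P\<^sub>H(n - k)\<close>
  (\<open>binomial_chromatic_poly_graph_join\<close>).

  Binomial convolution is multiplication of exponential generating functions
  (\<open>fps_mult_egf\<close>).  If \<open>F\<^sub>K\<close> denotes the power series with coefficients \<open>P\<^sub>K(n) / n!\<close>, the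
  identity says \<open>F\<^sub>G\<^sub>+\<^sub>H e\<^sup>x = F\<^sub>G F\<^sub>H\<close>.  Multiplication by \<open>e\<^sup>-\<^sup>x\<close>, the source of the signs,
  isolates \<open>F\<^sub>G\<^sub>+\<^sub>H\<close>, and the coefficients of the triple product \<open>F\<^sub>G F\<^sub>H e\<^sup>-\<^sup>x\<close> are the
  multinomial sums in the theorem.
\<close>

lemma card_proper_colourings_mono_inj:
  assumes "fin_digraph G" "finite B" "inj_on h A" "h ` A \<subseteq> B"
  shows "card (proper_colourings G A) \<le> card (proper_colourings G B)"
proof (rule card_inj_on_le)
  interpret fin_digraph G by fact
  let ?F = "\<lambda>f. \<lambda>x\<in>verts G. h (f x)"
  show "finite (proper_colourings G B)"
    using assms(2) by (simp add: finite_proper_colourings)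
  show "?F ` proper_colourings G A \<subseteq> proper_colourings G B"
    using assms(3,4) by (fastforce simp: proper_colourings_def PiE_iff inj_on_eq_iff)
  show "inj_on ?F (proper_colourings G A)"
  proof (rule inj_onI)
    fix f f' assume ff: "f \<in> proper_colourings G A" "f' \<in> proper_colourings G A" "?F f = ?F f'"
    have "f x = f' x" if "x \<in> verts G" for x
    proof -
      have "h (f x) = h (f' x)" using fun_cong[OF ff(3), of x] that by simp
      then show ?thesis
        using ff(1,2) that assms(3) by (auto simp: proper_colourings_def PiE_iff inj_on_eq_iff)
    qed
    then show "f = f'"
      using ff(1,2) by (auto simp: proper_colourings_def intro: PiE_ext)
  qed
qed

text \<open>
  The chromatic polynomial is defined by the palettes \<open>{..<q}\<close>, but the colours available to one
  side of the join form an arbitrary subset.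
\<close>
lemma card_proper_colourings:
  assumes "fin_digraph G" "finite A"
  shows "real (card (proper_colourings G A)) = poly (chromatic_poly G) (real (card A))"
proof -
  obtain h where h: "bij_betw h A {..<card A}"
    using ex_bij_betw_finite_nat[OF assms(2)] by (auto simp: atLeast0LessThan)
  have "card (proper_colourings G A) = card (proper_colourings G {..<card A})"
  proof (rule antisym)
    show "card (proper_colourings G A) \<le> card (proper_colourings G {..<card A})"
      using h by (intro card_proper_colourings_mono_inj[OF assms(1), of _ h])
        (auto simp: bij_betw_def)
    show "card (proper_colourings G {..<card A}) \<le> card (proper_colourings G A)"
      using bij_betw_inv_into[OF h] assms(2)
      by (intro card_proper_colourings_mono_inj[OF assms(1), of _ "inv_into A h"])
        (auto simp: bij_betw_def)
  qed
  then show ?thesis by (simp add: poly_chromatic_poly[OF assms(1)])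
qed

lemma proper_colourings_graph_join_iff:
  "h \<in> proper_colourings (graph_join G H) C \<longleftrightarrow>
     h \<in> extensional (Inl ` verts G \<union> Inr ` verts H) \<and>
     (\<lambda>u\<in>verts G. h (Inl u)) \<in> proper_colourings G C \<and>
     (\<lambda>v\<in>verts H. h (Inr v)) \<in> proper_colourings H C \<and>
     (\<forall>u\<in>verts G. \<forall>v\<in>verts H. h (Inl u) \<noteq> h (Inr v))"
  if "wf_digraph G" "wf_digraph H"
proof -
  interpret G: wf_digraph G by fact
  interpret H: wf_digraph H by fact
  show ?thesis
    by (auto 4 4 simp: proper_colourings_def graph_join_def PiE_iff ball_Un)
qed

text \<open>
  Match a colouring \<open>h\<close> of the join from \<open>V\<close> with the two restrictions of \<open>h\<close>, letting \<open>S\<close> be \<open>V\<close>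
  without the colours that \<open>h\<close> uses on \<open>H\<close>.  The colours used on \<open>G\<close> stay in \<open>S\<close> because vertices
  of \<open>G\<close> and \<open>H\<close> never share a colour, and those used on \<open>H\<close> lie outside \<open>S\<close> by construction.
  Conversely, \<open>V\<close> is recovered from \<open>S\<close> by adding the colours used on \<open>H\<close>.
\<close>
lemma sum_proper_colourings_graph_join:
  assumes "fin_digraph G" "fin_digraph H" "finite U"
  shows "(\<Sum>V\<in>Pow U. card (proper_colourings (graph_join G H) V)) =
         (\<Sum>S\<in>Pow U. card (proper_colourings G S) * card (proper_colourings H (U - S)))"
proof -
  interpret G: fin_digraph G by fact
  interpret H: fin_digraph H by fact
  let ?W = "Inl ` verts G \<union> Inr ` verts H"
  let ?J = "SIGMA V:Pow U. proper_colourings (graph_join G H) V"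
  let ?P = "SIGMA S:Pow U. proper_colourings G S \<times> proper_colourings H (U - S)"
  let ?split = "\<lambda>(V, h). (V - (\<lambda>v. h (Inr v)) ` verts H,
                  (\<lambda>u\<in>verts G. h (Inl u)), (\<lambda>v\<in>verts H. h (Inr v)))"
  let ?glue = "\<lambda>(S, f, g). (S \<union> g ` verts H, restrict (case_sum f g) ?W)"
  note iff = proper_colourings_graph_join_iff[OF G.wf_digraph H.wf_digraph]
  have bij: "bij_betw ?split ?J ?P"
  proof (rule bij_betw_byWitness[where f' = ?glue])
    show "\<forall>z\<in>?J. ?glue (?split z) = z"
    proof
      fix z assume "z \<in> ?J"
      then obtain V h where z: "z = (V, h)" and h: "h \<in> proper_colourings (graph_join G H) V"
        by auto
      have "(\<lambda>v. h (Inr v)) ` verts H \<subseteq> V"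
        using h unfolding iff by (auto simp: proper_colourings_def)
      moreover have "restrict (case_sum (\<lambda>u\<in>verts G. h (Inl u)) (\<lambda>v\<in>verts H. h (Inr v))) ?W = h"
        by (rule extensionalityI[of _ ?W]) (use h in \<open>auto simp: iff\<close>)
      ultimately show "?glue (?split z) = z" unfolding z by auto
    qed
    show "\<forall>z\<in>?P. ?split (?glue z) = z"
    proof
      fix z assume "z \<in> ?P"
      then obtain S f g where z: "z = (S, f, g)"
        and f: "f \<in> proper_colourings G S" and g: "g \<in> proper_colourings H (U - S)" by auto
      have "(\<lambda>u\<in>verts G. restrict (case_sum f g) ?W (Inl u)) = f"
           "(\<lambda>v\<in>verts H. restrict (case_sum f g) ?W (Inr v)) = g"
        by (rule extensionalityI[of _ "verts G"] extensionalityI[of _ "verts H"];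
            use f g in \<open>auto simp: proper_colourings_def PiE_iff\<close>)+
      moreover have "S \<inter> g ` verts H = {}"
        using g by (auto simp: proper_colourings_def)
      ultimately show "?split (?glue z) = z" unfolding z by auto
    qed
    show "?split ` ?J \<subseteq> ?P"
    proof (rule image_subsetI)
      fix z assume "z \<in> ?J"
      then obtain V h where z: "z = (V, h)" and V: "V \<subseteq> U"
        and h: "h \<in> proper_colourings (graph_join G H) V" by auto
      show "?split z \<in> ?P"
        using V h unfolding z iff by (auto simp: proper_colourings_def PiE_iff)
    qed
    show "?glue ` ?P \<subseteq> ?J"
    proof (rule image_subsetI)
      fix z assume "z \<in> ?P"
      then obtain S f g where z: "z = (S, f, g)" and S: "S \<subseteq> U"
        and f: "f \<in> proper_colourings G S" and g: "g \<in> proper_colourings H (U - S)" by auto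
      have "restrict (case_sum f g) ?W \<in> proper_colourings (graph_join G H) (S \<union> g ` verts H)"
        using S f g unfolding iff by (fastforce simp: proper_colourings_def PiE_iff)
      moreover have "S \<union> g ` verts H \<subseteq> U"
        using S g by (auto simp: proper_colourings_def)
      ultimately show "?glue z \<in> ?J" unfolding z by simp
    qed
  qed
  have fin: "finite (proper_colourings G S)" "finite (proper_colourings H S)"
    "finite (proper_colourings (graph_join G H) S)" if "S \<subseteq> U" for S
    using that assms(3)
    by (auto intro!: finite_proper_colourings intro: finite_subset simp: graph_join_def)
  have "(\<Sum>V\<in>Pow U. card (proper_colourings (graph_join G H) V)) = card ?J"
    by (rule card_SigmaI[symmetric]) (use assms(3) fin in auto)
  also have "\<dots> = card ?P" using bij by (rule bij_betw_same_card)
  also have "\<dots> = (\<Sum>S\<in>Pow U. card (proper_colourings G S \<times> proper_colourings H (U - S)))"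
    by (rule card_SigmaI) (use assms(3) fin in auto)
  finally show ?thesis by (simp add: card_cartesian_product)
qed

lemma sum_Pow_card:
  fixes f :: "nat \<Rightarrow> 'a :: comm_semiring_1"
  assumes "finite U"
  shows "(\<Sum>S\<in>Pow U. f (card S)) = (\<Sum>k\<le>card U. of_nat (card U choose k) * f k)"
proof -
  have "(\<Sum>S\<in>Pow U. f (card S)) = (\<Sum>k\<le>card U. \<Sum>S | S \<in> Pow U \<and> card S = k. f (card S))"
    by (rule sum.group[symmetric]) (use assms card_mono in auto)
  also have "\<dots> = (\<Sum>k\<le>card U. of_nat (card U choose k) * f k)"
    by (rule sum.cong) (simp_all add: n_subsets[OF assms])
  finally show ?thesis .
qed

lemma binomial_chromatic_poly_graph_join:
  assumes "pseudo_graph G" "pseudo_graph H"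
  shows "(\<Sum>k\<le>n. real (n choose k) * poly (chromatic_poly (graph_join G H)) (real k)) =
         (\<Sum>k\<le>n. real (n choose k) *
            (poly (chromatic_poly G) (real k) * poly (chromatic_poly H) (real (n - k))))"
proof -
  have fin: "fin_digraph G" "fin_digraph H" "fin_digraph (graph_join G H)"
    using assms pseudo_graph_graph_join[OF assms] by (auto simp: pseudo_graph_def)
  let ?U = "{..<n}"
  have finS: "finite S" if "S \<in> Pow ?U" for S
    using that by (auto intro: finite_subset)
  have "(\<Sum>k\<le>n. real (n choose k) * poly (chromatic_poly (graph_join G H)) (real k)) =
      (\<Sum>V\<in>Pow ?U. poly (chromatic_poly (graph_join G H)) (real (card V)))"
    by (subst sum_Pow_card) auto
  also have "\<dots> = real (\<Sum>V\<in>Pow ?U. card (proper_colourings (graph_join G H) V))"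
    unfolding of_nat_sum
    by (rule sum.cong) (use finS in \<open>auto simp: card_proper_colourings fin(3)\<close>)
  also have "\<dots> = (\<Sum>S\<in>Pow ?U. poly (chromatic_poly G) (real (card S)) *
                      poly (chromatic_poly H) (real (card ?U - card S)))"
    unfolding sum_proper_colourings_graph_join[OF fin(1,2) finite_lessThan] of_nat_sum of_nat_mult
    by (rule sum.cong)
      (use finS in \<open>auto simp: card_proper_colourings fin card_Diff_subset\<close>)
  also have "\<dots> = (\<Sum>k\<le>n. real (n choose k) *
            (poly (chromatic_poly G) (real k) * poly (chromatic_poly H) (real (n - k))))"
    by (subst sum_Pow_card[where f = "\<lambda>k. poly (chromatic_poly G) (real k) *
          poly (chromatic_poly H) (real (card {..<n} - k))"]) auto
  finally show ?thesis .
qed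

lemma fps_mult_egf:
  fixes a b :: "nat \<Rightarrow> 'a :: field_char_0"
  shows "Abs_fps (\<lambda>n. a n / fact n) * Abs_fps (\<lambda>n. b n / fact n) =
         Abs_fps (\<lambda>n. (\<Sum>k\<le>n. of_nat (n choose k) * (a k * b (n - k))) / fact n)"
proof (rule fps_ext)
  fix n
  show "fps_nth (Abs_fps (\<lambda>n. a n / fact n) * Abs_fps (\<lambda>n. b n / fact n)) n =
    fps_nth (Abs_fps (\<lambda>n. (\<Sum>k\<le>n. of_nat (n choose k) * (a k * b (n - k))) / fact n)) n"
    by (simp add: fps_mult_nth atMost_atLeast0 sum_divide_distrib)
      (rule sum.cong, simp_all add: binomial_fact field_simps)
qed

theorem theorem4p7:
  fixes G :: "('a, 'b) pre_digraph" and H :: "('c, 'd) pre_digraph" and q :: nat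
  assumes "pseudo_graph G" and "pseudo_graph H"
  shows "poly (chromatic_poly (graph_join G H)) (real q) =
    (\<Sum>(s, t) \<in> {(s, t). s + t \<le> q}.
       (-1) ^ (q - s - t) * (fact q / (fact s * fact t * fact (q - s - t)))
       * poly (chromatic_poly G) (real s) * poly (chromatic_poly H) (real t))"
proof -
  define A where "A = Abs_fps (\<lambda>n. poly (chromatic_poly G) (real n) / fact n)"
  define B where "B = Abs_fps (\<lambda>n. poly (chromatic_poly H) (real n) / fact n)"
  define J where "J = Abs_fps (\<lambda>n. poly (chromatic_poly (graph_join G H)) (real n) / fact n)"
  have exp: "fps_exp 1 = Abs_fps (\<lambda>n. (1::real) / fact n)"
    by (rule fps_ext) simp
  \<comment> \<open>Multiplication by the exponential series is binomial convolution with the constant sequence 1.\<close>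
  have "J * fps_exp 1 = A * B"
    unfolding J_def A_def B_def exp fps_mult_egf
    by (simp add: binomial_chromatic_poly_graph_join[OF assms])
  then have "J * (fps_exp 1 * fps_exp (- 1)) = A * B * fps_exp (- 1)"
    by (simp add: mult.assoc)
  then have J: "J = A * B * fps_exp (- 1)"
    by (simp flip: fps_exp_add_mult)
  have "poly (chromatic_poly (graph_join G H)) (real q) = fact q * fps_nth (A * B * fps_exp (- 1)) q"
    unfolding J[symmetric] by (simp add: J_def)
  \<comment> \<open>The exponent \<open>q - k\<close> is written as \<open>q - s - (k - s)\<close> so that the summand is literally a
     function of \<open>s\<close> and \<open>t = k - s\<close>, as the reindexing of the triangle requires.\<close>
  also have "\<dots> = (\<Sum>k\<le>q. \<Sum>s\<le>k. (-1) ^ (q - s - (k - s)) *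
       (fact q / (fact s * fact (k - s) * fact (q - s - (k - s))))
       * poly (chromatic_poly G) (real s) * poly (chromatic_poly H) (real (k - s)))"
    unfolding fps_mult_nth[of "A * B"] fps_mult_nth[of A]
    by (simp add: A_def B_def atMost_atLeast0 sum_distrib_left sum_distrib_right
        mult_ac)
  finally show ?thesis by (simp only: sum.triangle_reindex_eq)
qed

end
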